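(* Let $A$ be a complete equicharacteristic, residually rational one-dimensional local domain of multiplicity $e$ with infinite residue field $k$ and maximal ideal $\mathfrak m$, i.e. a local subring of a formal power series ring $k[[t]]$ with conductor $(A:k[[t]])\ne 0$. Let $v$ be the $t$-adic valuation and let $x\in A$ be an element of smallest positive value, $v(x)=e$. Let $\{g_0=1,g_1,\dots,g_{e-1}\}$ be an Apery basis of $A$ with respect to $x$ and, for $1\le j\le e-1$, put $c_j=\max\{i\mid g_j\in\mathfrak m^i+xA\}$. Then for every $i\ge 1$, $$\gamma_i=\#\{j\mid 1\le j\le e-1,\ c_j=i\}.$$
   Context: $\lambda$ denotes length of $A$-modules and $\mathfrak m^0=A$. The Apery invariants of $A$ with respect to $x$ are $\gamma_i=\lambda\left(\dfrac{\mathfrak m^i+xA}{\mathfrak m^{i+1}+xA}\right)$. The value semigroup of $A$ is $S=v(A)=\{v(a):0\ne a\in A\}$, and for an ideal $I$ of $A$ we write $v(I)=\{v(a):0\ne a\in I\}$. The Apery set of $S$ with respect to $e$ is $\mathrm{Ap}(S)=\{w_0=0,w_1,\dots,w_{e-1}\}$, the set of the smallest elements of $S$ in each congruence class modulo $e$. A subset $\{g_0=1,g_1,\dots,g_{e-1}\}$ of $A$ is an Apery basis with respect to $x$ if for each $1\le j\le e-1$: (1) $v(g_j)=w_j$; (2) $\max\{i\mid g_j\in\mathfrak m^i+xA\}=\max\{i\mid w_j\in v(\mathfrak m^i+xA)\}$. *)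

theory Defs
  imports
    "HOL-Algebra.Algebra"
    "HOL-Computational_Algebra.Formal_Power_Series"
    "HOL-Library.Extended_Real"
begin

section \<open>Modules: quotients and length\<close>

definition ideal_module :: "('a, 'm) ring_scheme \<Rightarrow> 'a set \<Rightarrow> ('a, 'a) module" where
  "ideal_module R I =
     \<lparr>carrier = I, monoid.mult = monoid.mult R, monoid.one = monoid.one R,
      ring.zero = ring.zero R, ring.add = ring.add R, smult = monoid.mult R\<rparr>"

text \<open>
  The library's module records extend ring records; the fields mult and one carry no
  information for a module and are unspecified in the quotient.  The scalar action sends a coset
  N + a to N + r a.
\<close>

definition quotient_module ::
    "('a, 'b, 'm) module_scheme \<Rightarrow> 'b set \<Rightarrow> ('a, 'b set) module" where
  "quotient_module M N =
     \<lparr>carrier = A_RCOSETS M N, monoid.mult = undefined, monoid.one = undefined,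
      ring.zero = N, ring.add = set_add M, smult = (\<lambda>r C. set_add M N (smult M r ` C))\<rparr>"

text \<open>Length: supremum of the lengths n of strict chains of submodules
  C 0, ..., C n (infinity if these are unbounded).\<close>

definition module_length :: "('a, 'm) ring_scheme \<Rightarrow> ('a, 'b, 'n) module_scheme \<Rightarrow> enat" where
  "module_length R M =
     Sup {enat n | n. \<exists>C. (\<forall>i\<le>n. submodule (C i) R M) \<and> (\<forall>i<n. C i \<subset> C (Suc i))}"


section \<open>Local rings\<close>

definition local_ring :: "('a, 'm) ring_scheme \<Rightarrow> 'a set \<Rightarrow> bool" where
  "local_ring R \<mm> \<longleftrightarrow>
     cring R \<and> maximalideal \<mm> R \<and> (\<forall>J. maximalideal J R \<longrightarrow> J = \<mm>)"

text \<open>Powers in the monoid of ideals; the 0-th power is the whole ring.\<close>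

definition ideal_power :: "('a, 'm) ring_scheme \<Rightarrow> 'a set \<Rightarrow> nat \<Rightarrow> 'a set" where
  "ideal_power R I n = I [^]\<^bsub>ideals_set R\<^esub> n"

text \<open>Hilbert-Samuel multiplicity of a local ring of dimension one:
  the limit of length(R / \<mm>^n) / n.\<close>

definition has_multiplicity_dim1 :: "('a, 'm) ring_scheme \<Rightarrow> 'a set \<Rightarrow> nat \<Rightarrow> bool" where
  "has_multiplicity_dim1 R \<mm> e \<longleftrightarrow>
     (\<lambda>n. ereal_of_enat (module_length R
              (quotient_module (ideal_module R (carrier R)) (ideal_power R \<mm> n)))
            / ereal (real n)) \<longlonglongrightarrow> ereal (real e)"


section \<open>Subrings of a power series ring\<close>

definition fps_ring :: "('k::field) fps ring" where
  "fps_ring = \<lparr>carrier = UNIV, monoid.mult = (*), monoid.one = 1, ring.zero = 0, ring.add = (+)\<rparr>"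

definition fps_subring :: "('k::field) fps set \<Rightarrow> 'k fps ring" where
  "fps_subring A = fps_ring\<lparr>carrier := A\<rparr>"

definition conductor :: "('k::field) fps set \<Rightarrow> 'k fps set" where
  "conductor A = {f. \<forall>h. f * h \<in> A}"

text \<open>
  A local subring A of k[[t]], with maximal ideal \<mm> and nonzero conductor.
  The condition on constant coefficients is residual rationality: the residue field of A
  maps onto the residue field k of k[[t]].  It is not assumed that A contains the constants.
\<close>

definition residually_rational_local_subring ::
    "('k::field) fps set \<Rightarrow> 'k fps set \<Rightarrow> bool" where
  "residually_rational_local_subring A \<mm> \<longleftrightarrow>
     subring A fps_ring \<and> local_ring (fps_subring A) \<mm> \<and>
     conductor A \<noteq> {0} \<and> (\<lambda>f. fps_nth f 0) ` A = UNIV"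

definition value_set :: "('k::field) fps set \<Rightarrow> nat set" where
  "value_set I = subdegree ` (I - {0})"


section \<open>Apery sets, bases and invariants\<close>

definition apery_set :: "nat set \<Rightarrow> nat \<Rightarrow> nat set" where
  "apery_set S e = {s \<in> S. \<forall>s'\<in>S. s' mod e = s mod e \<longrightarrow> s \<le> s'}"

text \<open>The ideal \<mm>^i + xA.\<close>

definition apery_filtration ::
    "('k::field) fps set \<Rightarrow> 'k fps set \<Rightarrow> 'k fps \<Rightarrow> nat \<Rightarrow> 'k fps set" where
  "apery_filtration A \<mm> x i =
     ideal_power (fps_subring A) \<mm> i <+>\<^bsub>fps_subring A\<^esub> PIdl\<^bsub>fps_subring A\<^esub> x"

definition apery_invariant ::
    "('k::field) fps set \<Rightarrow> 'k fps set \<Rightarrow> 'k fps \<Rightarrow> nat \<Rightarrow> enat" where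
  "apery_invariant A \<mm> x i =
     module_length (fps_subring A)
       (quotient_module (ideal_module (fps_subring A) (apery_filtration A \<mm> x i))
          (apery_filtration A \<mm> x (Suc i)))"

text \<open>
  The sequence w is an arbitrary enumeration of the Apery set starting with 0.
  The index sets of the maxima are finite and nonempty in the situation of interest
  (x of minimal positive value e): the 0-th filtration step is A, while w j is not a value
  of xA and high powers of \<mm> lie in xA.
\<close>

definition apery_basis ::
    "('k::field) fps set \<Rightarrow> 'k fps set \<Rightarrow> 'k fps \<Rightarrow> nat \<Rightarrow> (nat \<Rightarrow> nat) \<Rightarrow> (nat \<Rightarrow> 'k fps) \<Rightarrow> bool"
  where
  "apery_basis A \<mm> x e w g \<longleftrightarrow>
     w 0 = 0 \<and> bij_betw w {0..<e} (apery_set (value_set A) e) \<and>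
     g 0 = 1 \<and>
     (\<forall>j\<in>{1..<e}. g j \<in> A \<and> g j \<noteq> 0 \<and> subdegree (g j) = w j \<and>
        Max {i. g j \<in> apery_filtration A \<mm> x i} =
        Max {i. w j \<in> value_set (apery_filtration A \<mm> x i)})"

end

theory Submission
  imports Defs
begin

text \<open>
  Write \<open>F i\<close> for the ideal \<open>\<mm>^i + xA\<close> and \<open>v\<close> for the order of vanishing.  The Apery invariant is
  the length of \<open>F i / F (i + 1)\<close>, and lengths of this kind count values: if \<open>J \<subseteq> I\<close> are ideals of \<open>A\<close>
  and \<open>J\<close> contains all series of high order, then the length of \<open>I / J\<close> is the number of elements
  of \<open>v(I) - v(J)\<close> (\<open>length_eq_card_value_diff\<close>).  It is at most this number because nested ideals
  with the same values are equal: by residual rationality, any element of the larger one can be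
  corrected, one leading coefficient after the other, by elements of the smaller one until its
  order is so high that it belongs to the smaller one anyway.  It is at least this number because
  the ideals of those elements of \<open>I\<close> that agree with an element of \<open>J\<close> up to order \<open>s\<close> shrink
  strictly whenever \<open>s\<close> passes an element of \<open>v(I) - v(J)\<close>.

  It remains to identify \<open>v(F i) - v(F (i + 1))\<close>.  As \<open>F (i + 1)\<close> contains \<open>xA\<close>, whose values are
  those of \<open>A\<close> shifted by \<open>e\<close>, a value of \<open>A\<close> missing from \<open>v(F (i + 1))\<close> is an Apery element \<open>w j\<close>
  (\<open>value_not_F_imp_apery\<close>), and \<open>j \<noteq> 0\<close> if \<open>i \<ge> 1\<close>, because \<open>F i\<close> then has no elements of value 0.
  Conversely, an Apery element is not a value of \<open>xA\<close>, and \<open>F n\<close> lies in \<open>xA\<close> for large \<open>n\<close>; as the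
  ideals decrease, \<open>w j\<close> is a value of exactly those \<open>F i\<close> with \<open>i \<le> Max {i. w j \<in> v(F i)}\<close>
  (\<open>value_F_iff_le_Max\<close>).  For an Apery basis this maximum is \<open>c j\<close>, so \<open>v(F i) - v(F (i + 1))\<close>
  consists of the \<open>w j\<close> with \<open>c j = i\<close>.
\<close>

unbundle fps_syntax

section \<open>Orders of vanishing\<close>

text \<open>
  Defined by coefficients because the zero series, whose \<open>subdegree\<close> is 0, has to belong to
  \<open>order_ge n\<close> for every \<open>n\<close>.
\<close>

definition order_ge :: "nat \<Rightarrow> ('k::field) fps set" where
  "order_ge n = {f. \<forall>i<n. f $ i = 0}"

lemma order_ge_iff: "f \<in> order_ge n \<longleftrightarrow> f = 0 \<or> n \<le> subdegree f"
  unfolding order_ge_def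
  by (auto intro: subdegree_geI nth_less_subdegree_zero less_le_trans)

lemma order_ge_zero [simp]: "0 \<in> order_ge n"
  and order_ge_add: "f \<in> order_ge n \<Longrightarrow> g \<in> order_ge n \<Longrightarrow> f + g \<in> order_ge n"
  and order_ge_0 [simp]: "f \<in> order_ge 0"
  and order_ge_mono: "f \<in> order_ge n \<Longrightarrow> m \<le> n \<Longrightarrow> f \<in> order_ge m"
  by (auto simp: order_ge_def)

lemma order_ge_mult: "f \<in> order_ge m \<Longrightarrow> g \<in> order_ge n \<Longrightarrow> f * g \<in> order_ge (m + n)"
  unfolding order_ge_iff by (cases "f = 0 \<or> g = 0") auto

lemma order_ge_mult_left: "f \<in> order_ge n \<Longrightarrow> a * f \<in> order_ge n"
  using order_ge_mult[of a 0 f n] by simp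

lemma order_ge_imp_dvd:
  assumes "f \<noteq> 0" "g \<in> order_ge (subdegree f + n)"
  obtains h where "g = f * h" "h \<in> order_ge n"
proof (cases "g = 0")
  case True
  then show ?thesis using that[of 0] by simp
next
  case False
  then have "subdegree f + n \<le> subdegree g"
    using assms(2) by (simp add: order_ge_iff)
  then have "f dvd g"
    using fps_dvd_iff[OF assms(1) False] by simp
  then obtain h where h: "g = f * h" by (rule dvdE)
  with False \<open>subdegree f + n \<le> subdegree g\<close> have "n \<le> subdegree h" by simp
  with h show ?thesis using that[of h] by (simp add: order_ge_iff)
qed

lemma value_set_mono: "I \<subseteq> J \<Longrightarrow> value_set I \<subseteq> value_set J"
  by (auto simp: value_set_def)

lemma value_setE:
  assumes "s \<in> value_set I"
  obtains f where "f \<in> I" "f \<noteq> 0" "subdegree f = s"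
  using assms by (auto simp: value_set_def)


section \<open>Ideals of a subring of the power series ring\<close>

lemma fps_ring_simps [simp]:
  "carrier fps_ring = UNIV" "monoid.mult fps_ring = (*)" "monoid.one fps_ring = 1"
  "ring.zero fps_ring = 0" "ring.add fps_ring = (+)"
  by (simp_all add: fps_ring_def)

lemma fps_subring_simps [simp]:
  "carrier (fps_subring A) = A" "monoid.mult (fps_subring A) = (*)"
  "monoid.one (fps_subring A) = 1" "ring.zero (fps_subring A) = 0"
  "ring.add (fps_subring A) = (+)"
  by (simp_all add: fps_subring_def fps_ring_def)

lemma cring_fps_ring: "cring (fps_ring :: ('k::field) fps ring)"
proof (rule cringI)
  show "abelian_group (fps_ring :: 'k fps ring)"
  proof (rule abelian_groupI; simp add: algebra_simps)
    fix f :: "'k fps"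
    show "\<exists>g. f + g = 0" by (rule exI[of _ "- f"]) simp
  qed
  show "Group.comm_monoid (fps_ring :: 'k fps ring)"
    by (rule comm_monoidI) (simp_all add: algebra_simps)
qed (simp add: algebra_simps)

locale power_series_subring =
  fixes A :: "('k::field) fps set"
  assumes subring_A: "subring A fps_ring"
begin

lemma ring_A: "ring (fps_subring A)"
  using ring.subring_is_ring[OF cring.axioms(1)[OF cring_fps_ring] subring_A]
  by (simp add: fps_subring_def)

lemma minus_fps_ring: "a_inv fps_ring (f :: 'k fps) = - f"
proof -
  interpret ring "fps_ring :: 'k fps ring"
    using cring_fps_ring by (rule cring.axioms)
  show ?thesis by (rule minus_equality) simp_all
qed

lemma one_A: "1 \<in> A" and zero_A: "0 \<in> A"
  and add_A: "f \<in> A \<Longrightarrow> g \<in> A \<Longrightarrow> f + g \<in> A"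
  and mult_A: "f \<in> A \<Longrightarrow> g \<in> A \<Longrightarrow> f * g \<in> A"
  and minus_A: "f \<in> A \<Longrightarrow> - f \<in> A"
  using subringE[OF subring_A] by (auto simp: minus_fps_ring)

lemma a_inv_A: "f \<in> A \<Longrightarrow> a_inv (fps_subring A) f = - f"
proof -
  interpret ring "fps_subring A" by (rule ring_A)
  assume "f \<in> A"
  then show ?thesis by (intro minus_equality) (simp_all add: minus_A)
qed

lemma ideal_iff:
  "ideal I (fps_subring A) \<longleftrightarrow>
     I \<subseteq> A \<and> 0 \<in> I \<and> (\<forall>f\<in>I. \<forall>g\<in>I. f + g \<in> I) \<and> (\<forall>a\<in>A. \<forall>f\<in>I. a * f \<in> I)"
  (is "_ \<longleftrightarrow> ?R")
proof
  assume "ideal I (fps_subring A)"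
  then interpret ideal I "fps_subring A" .
  show ?R
    using a_subset additive_subgroup.zero_closed[OF is_additive_subgroup]
      additive_subgroup.a_closed[OF is_additive_subgroup] I_l_closed by auto
next
  assume R: ?R
  show "ideal I (fps_subring A)"
  proof (rule idealI[OF ring_A])
    show "subgroup I (add_monoid (fps_subring A))"
    proof (rule subgroup.intro)
      fix f assume f: "f \<in> I"
      then have "(- 1) * f \<in> I" using R minus_A[OF one_A] by blast
      moreover have "f \<in> A" using f R by blast
      ultimately show "inv\<^bsub>add_monoid (fps_subring A)\<^esub> f \<in> I"
        using a_inv_A[of f] by (simp add: a_inv_def)
    qed (use R in auto)
    show "a \<otimes>\<^bsub>fps_subring A\<^esub> b \<in> I"
      if "a \<in> I" "b \<in> carrier (fps_subring A)" for a b
    proof -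
      have "b * a \<in> I" using R that by simp
      then show ?thesis by (simp add: mult.commute)
    qed
  qed (use R in auto)
qed

lemma ideal_subset: "ideal I (fps_subring A) \<Longrightarrow> I \<subseteq> A"
  and ideal_zero: "ideal I (fps_subring A) \<Longrightarrow> 0 \<in> I"
  and ideal_add: "ideal I (fps_subring A) \<Longrightarrow> f \<in> I \<Longrightarrow> g \<in> I \<Longrightarrow> f + g \<in> I"
  and ideal_mult: "ideal I (fps_subring A) \<Longrightarrow> a \<in> A \<Longrightarrow> f \<in> I \<Longrightarrow> a * f \<in> I"
  by (simp_all add: ideal_iff)

lemma ideal_minus: "ideal I (fps_subring A) \<Longrightarrow> f \<in> I \<Longrightarrow> - f \<in> I"
  using ideal_mult[of I "- 1" f] minus_A[OF one_A] by simp

lemma ideal_diff: "ideal I (fps_subring A) \<Longrightarrow> f \<in> I \<Longrightarrow> g \<in> I \<Longrightarrow> f - g \<in> I"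
  using ideal_add[of I f "- g"] ideal_minus[of I g] by simp

end


section \<open>Submodules of a quotient of ideals\<close>

definition add_coset :: "('k::field) fps set \<Rightarrow> 'k fps \<Rightarrow> 'k fps set" where
  "add_coset J f = (\<lambda>j. j + f) ` J"

abbreviation (input) ideal_quotient ::
    "('k::field) fps set \<Rightarrow> 'k fps set \<Rightarrow> 'k fps set \<Rightarrow> ('k fps, 'k fps set) module" where
  "ideal_quotient A I J \<equiv> quotient_module (ideal_module (fps_subring A) I) J"

context power_series_subring
begin

lemma quotient_carrier: "carrier (ideal_quotient A I J) = add_coset J ` I"
  by (auto simp: quotient_module_def ideal_module_def A_RCOSETS_def' a_r_coset_def'
      add_coset_def A_RCOSETS_defs r_coset_def)

lemma quotient_zero: "ring.zero (ideal_quotient A I J) = J"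
  by (simp add: quotient_module_def)

lemma add_coset_eq_iff:
  assumes J: "ideal J (fps_subring A)"
  shows "add_coset J f = add_coset J g \<longleftrightarrow> f - g \<in> J"
proof
  assume eq: "add_coset J f = add_coset J g"
  have "0 + f \<in> add_coset J f"
    using ideal_zero[OF J] unfolding add_coset_def by (rule imageI)
  with eq obtain j where "j \<in> J" "f = j + g"
    by (auto simp: add_coset_def)
  then show "f - g \<in> J" by simp
next
  have sub: "add_coset J f \<subseteq> add_coset J g" if "f - g \<in> J" for f g
  proof
    fix h assume "h \<in> add_coset J f"
    then obtain j where j: "j \<in> J" "h = j + f" by (auto simp: add_coset_def)
    have "j + (f - g) \<in> J" using ideal_add[OF J j(1) that] .
    then have "j + (f - g) + g \<in> add_coset J g"
      unfolding add_coset_def by (rule imageI)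
    then show "h \<in> add_coset J g" using j by simp
  qed
  assume "f - g \<in> J"
  moreover from this have "g - f \<in> J" using ideal_minus[OF J, of "f - g"] by simp
  ultimately show "add_coset J f = add_coset J g" using sub by blast
qed

lemma add_coset_eq_self_iff:
  assumes "ideal J (fps_subring A)"
  shows "add_coset J f = J \<longleftrightarrow> f \<in> J"
  using add_coset_eq_iff[OF assms, of f 0] by (simp add: add_coset_def)

lemma quotient_add:
  assumes J: "ideal J (fps_subring A)"
  shows "ring.add (ideal_quotient A I J) (add_coset J f) (add_coset J g) = add_coset J (f + g)"
proof -
  have "ring.add (ideal_quotient A I J) (add_coset J f) (add_coset J g) =
        {u + v | u v. u \<in> add_coset J f \<and> v \<in> add_coset J g}"
    by (auto simp: quotient_module_def ideal_module_def set_add_def')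
  also have "\<dots> = add_coset J (f + g)"
  proof (intro equalityI subsetI)
    fix h assume "h \<in> {u + v | u v. u \<in> add_coset J f \<and> v \<in> add_coset J g}"
    then obtain i j where "i \<in> J" "j \<in> J" "h = (i + f) + (j + g)"
      by (auto simp: add_coset_def)
    then have "i + j \<in> J" "h = (i + j) + (f + g)"
      using ideal_add[OF J] by (auto simp: algebra_simps)
    then show "h \<in> add_coset J (f + g)" by (auto simp: add_coset_def)
  next
    fix h assume "h \<in> add_coset J (f + g)"
    then obtain j where "j \<in> J" "h = (j + f) + (0 + g)"
      by (auto simp: add_coset_def algebra_simps)
    then show "h \<in> {u + v | u v. u \<in> add_coset J f \<and> v \<in> add_coset J g}"
      using ideal_zero[OF J] unfolding add_coset_def by blast
  qed
  finally show ?thesis .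
qed

lemma quotient_smult:
  assumes J: "ideal J (fps_subring A)" and a: "a \<in> A"
  shows "smult (ideal_quotient A I J) a (add_coset J f) = add_coset J (a * f)"
proof -
  have "smult (ideal_quotient A I J) a (add_coset J f) =
        {u + a * v | u v. u \<in> J \<and> v \<in> add_coset J f}"
    by (auto simp: quotient_module_def ideal_module_def set_add_def')
  also have "\<dots> = add_coset J (a * f)"
  proof (intro equalityI subsetI)
    fix h assume "h \<in> {u + a * v | u v. u \<in> J \<and> v \<in> add_coset J f}"
    then obtain i j where "i \<in> J" "j \<in> J" "h = i + a * (j + f)"
      by (auto simp: add_coset_def)
    moreover from this have "i + a * j \<in> J" by (intro ideal_add[OF J] ideal_mult[OF J a])
    ultimately have "i + a * j \<in> J" "h = (i + a * j) + a * f"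
      by (simp_all add: algebra_simps)
    then show "h \<in> add_coset J (a * f)" by (auto simp: add_coset_def)
  next
    fix h assume "h \<in> add_coset J (a * f)"
    then obtain j where "j \<in> J" "h = j + a * (0 + f)"
      by (auto simp: add_coset_def)
    then show "h \<in> {u + a * v | u v. u \<in> J \<and> v \<in> add_coset J f}"
      using ideal_zero[OF J] unfolding add_coset_def by blast
  qed
  finally show ?thesis .
qed

text \<open>
  The correspondence theorem for \<open>I / J\<close>, on which the computation of lengths rests: submodules are
  turned into the ideals between \<open>J\<close> and \<open>I\<close> by taking preimages, and back by taking images.
\<close>

lemma submodule_preimage:
  assumes I: "ideal I (fps_subring A)" and J: "ideal J (fps_subring A)" and "J \<subseteq> I"
    and C: "submodule C (fps_subring A) (ideal_quotient A I J)"
  shows "ideal {f \<in> I. add_coset J f \<in> C} (fps_subring A)"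
    and "J \<subseteq> {f \<in> I. add_coset J f \<in> C}"
    and "C = add_coset J ` {f \<in> I. add_coset J f \<in> C}"
proof -
  let ?Q = "ideal_quotient A I J" and ?K = "{f \<in> I. add_coset J f \<in> C}"
  have C': "subgroup C (add_monoid ?Q)" using C by (rule submodule.axioms)
  have sub: "C \<subseteq> add_coset J ` I"
    using subgroup.subset[OF C'] by (simp add: quotient_carrier)
  have zero: "J \<in> C"
    using subgroup.one_closed[OF C'] by (simp add: quotient_zero)
  have add: "add_coset J (f + g) \<in> C" if "add_coset J f \<in> C" "add_coset J g \<in> C" for f g
    using subgroup.m_closed[OF C' that] by (simp add: quotient_add[OF J])
  have smult: "add_coset J (a * f) \<in> C" if "a \<in> A" "add_coset J f \<in> C" for a f
    using submodule.smult_closed[OF C, of a "add_coset J f"] that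
    by (simp add: quotient_smult[OF J])
  show J_sub: "J \<subseteq> ?K"
  proof
    fix f assume f: "f \<in> J"
    then have "add_coset J f = J" by (simp add: add_coset_eq_self_iff[OF J])
    with zero f \<open>J \<subseteq> I\<close> show "f \<in> ?K" by auto
  qed
  show "C = add_coset J ` ?K"
    using sub by auto
  show "ideal ?K (fps_subring A)"
    unfolding ideal_iff
  proof (intro conjI ballI)
    show "?K \<subseteq> A" using ideal_subset[OF I] by blast
    show "0 \<in> ?K" using J_sub ideal_zero[OF J] by blast
    show "f + g \<in> ?K" if "f \<in> ?K" "g \<in> ?K" for f g
      using that add[of f g] ideal_add[OF I, of f g] by simp
    show "a * f \<in> ?K" if "a \<in> A" "f \<in> ?K" for a f
      using that smult[of a f] ideal_mult[OF I, of a f] by simp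
  qed
qed

lemma submodule_image:
  assumes J: "ideal J (fps_subring A)" and K: "ideal K (fps_subring A)" and "J \<subseteq> K" "K \<subseteq> I"
    and I: "ideal I (fps_subring A)"
  shows "submodule (add_coset J ` K) (fps_subring A) (ideal_quotient A I J)"
proof (intro submodule.intro subgroup.intro submodule_axioms.intro)
  let ?Q = "ideal_quotient A I J"
  show "add_coset J ` K \<subseteq> carrier (add_monoid ?Q)"
    using \<open>K \<subseteq> I\<close> by (auto simp: quotient_carrier)
  show "U \<otimes>\<^bsub>add_monoid ?Q\<^esub> V \<in> add_coset J ` K"
    if "U \<in> add_coset J ` K" "V \<in> add_coset J ` K" for U V
    using that ideal_add[OF K] by (auto simp: quotient_add[OF J])
  show "\<one>\<^bsub>add_monoid ?Q\<^esub> \<in> add_coset J ` K"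
    using add_coset_eq_self_iff[OF J, of 0] ideal_zero[OF J] ideal_zero[OF K]
    by (auto simp: quotient_zero intro: rev_image_eqI)
  show "smult ?Q a U \<in> add_coset J ` K"
    if "a \<in> carrier (fps_subring A)" "U \<in> add_coset J ` K" for a U
    using that ideal_mult[OF K] by (auto simp: quotient_smult[OF J])
  show "inv\<^bsub>add_monoid ?Q\<^esub> U \<in> add_coset J ` K" if "U \<in> add_coset J ` K" for U
  proof -
    from that obtain f where f: "f \<in> K" "U = add_coset J f" by auto
    have "inv\<^bsub>add_monoid ?Q\<^esub> U = add_coset J (- f)"
      unfolding m_inv_def
    proof (rule the_equality)
      have "- f \<in> I" using ideal_minus[OF K f(1)] \<open>K \<subseteq> I\<close> by blast
      then show "add_coset J (- f) \<in> carrier (add_monoid ?Q) \<and>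
          U \<otimes>\<^bsub>add_monoid ?Q\<^esub> add_coset J (- f) = \<one>\<^bsub>add_monoid ?Q\<^esub> \<and>
          add_coset J (- f) \<otimes>\<^bsub>add_monoid ?Q\<^esub> U = \<one>\<^bsub>add_monoid ?Q\<^esub>"
        using add_coset_eq_self_iff[OF J, of 0] ideal_zero[OF J]
        by (simp add: f(2) quotient_add[OF J] quotient_zero quotient_carrier)
    next
      fix V assume V: "V \<in> carrier (add_monoid ?Q) \<and>
          U \<otimes>\<^bsub>add_monoid ?Q\<^esub> V = \<one>\<^bsub>add_monoid ?Q\<^esub> \<and>
          V \<otimes>\<^bsub>add_monoid ?Q\<^esub> U = \<one>\<^bsub>add_monoid ?Q\<^esub>"
      then obtain g where g: "V = add_coset J g" by (auto simp: quotient_carrier)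
      with V have "g + f \<in> J"
        by (simp add: f(2) quotient_add[OF J] quotient_zero add_coset_eq_self_iff[OF J])
      then show "V = add_coset J (- f)"
        by (simp add: g add_coset_eq_iff[OF J])
    qed
    then show ?thesis using ideal_minus[OF K f(1)] by simp
  qed
qed

text \<open>
  Inclusions stay strict under both passages.  Preimages determine the submodule, since it is
  their image.  An ideal \<open>K\<close> containing \<open>J\<close> is determined by its image, since \<open>f - g \<in> J\<close> and
  \<open>g \<in> K\<close> imply \<open>f \<in> K\<close>.
\<close>

lemma submodule_chain_iff_ideal_chain:
  assumes I: "ideal I (fps_subring A)" and J: "ideal J (fps_subring A)" and JI: "J \<subseteq> I"
  shows "(\<exists>C. (\<forall>i\<le>n. submodule (C i) (fps_subring A) (ideal_quotient A I J)) \<and>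
              (\<forall>i<n. C i \<subset> C (Suc i))) \<longleftrightarrow>
         (\<exists>K. (\<forall>i\<le>n. ideal (K i) (fps_subring A) \<and> J \<subseteq> K i \<and> K i \<subseteq> I) \<and>
              (\<forall>i<n. K i \<subset> K (Suc i)))"
  (is "(\<exists>C. ?sub C) \<longleftrightarrow> (\<exists>K. ?ids K)")
proof
  assume "\<exists>C. ?sub C"
  then obtain C where C: "?sub C" by (rule exE)
  define K where "K i = {f \<in> I. add_coset J f \<in> C i}" for i
  have K: "ideal (K i) (fps_subring A)" "J \<subseteq> K i" "C i = add_coset J ` K i" if "i \<le> n" for i
    using submodule_preimage[OF I J JI, of "C i"] C that unfolding K_def by auto
  have "K i \<subset> K (Suc i)" if "i < n" for i
  proof -
    have "C i \<subset> C (Suc i)" using C that by blast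
    then have "K i \<subseteq> K (Suc i)" unfolding K_def by blast
    moreover have "K i \<noteq> K (Suc i)"
      using K(3)[of i] K(3)[of "Suc i"] \<open>C i \<subset> C (Suc i)\<close> that by auto
    ultimately show ?thesis by blast
  qed
  moreover have "K i \<subseteq> I" for i unfolding K_def by blast
  ultimately have "?ids K" using K(1,2) by simp
  then show "\<exists>K. ?ids K" by (rule exI[of _ K])
next
  assume "\<exists>K. ?ids K"
  then obtain K where K: "?ids K" by (rule exE)
  define C where "C i = add_coset J ` K i" for i
  have "submodule (C i) (fps_subring A) (ideal_quotient A I J)" if "i \<le> n" for i
    using submodule_image[OF J _ _ _ I, of "K i"] K that unfolding C_def by simp
  moreover have "C i \<subset> C (Suc i)" if i: "i < n" for i
  proof -
    from K i have Ki: "ideal (K i) (fps_subring A)" "J \<subseteq> K i" "K i \<subset> K (Suc i)" by auto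
    then obtain f where f: "f \<in> K (Suc i)" "f \<notin> K i" by blast
    have "add_coset J f \<notin> C i"
    proof
      assume "add_coset J f \<in> C i"
      then obtain g where g: "g \<in> K i" "f - g \<in> J"
        unfolding C_def by (auto simp: add_coset_eq_iff[OF J])
      then have "g + (f - g) \<in> K i" using Ki ideal_add[OF Ki(1)] by blast
      with f show False by simp
    qed
    moreover have "add_coset J f \<in> C (Suc i)" using f by (simp add: C_def)
    moreover have "C i \<subseteq> C (Suc i)" using Ki unfolding C_def by blast
    ultimately show ?thesis by blast
  qed
  ultimately have "?sub C" by simp
  then show "\<exists>C. ?sub C" by (rule exI[of _ C])
qed

end


section \<open>Lengths count values\<close>

locale residually_rational_subring = power_series_subring A for A :: "('k::field) fps set" +
  assumes residually_rational: "(\<lambda>f. fps_nth f 0) ` A = UNIV"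
begin

text \<open>
  An element \<open>f\<close> of \<open>L\<close> of order \<open>s\<close> has the same value as some \<open>h\<close> in \<open>K\<close>.  As the constant
  coefficients of \<open>A\<close> exhaust the field, some \<open>a\<close> in \<open>A\<close> makes \<open>a * h\<close> agree with \<open>f\<close> in degree \<open>s\<close>,
  so \<open>f - a * h\<close> has larger order.  The induction counts down the distance of the order to \<open>N\<close>.
\<close>

lemma ideal_subset_if_value_set_subset:
  assumes K: "ideal K (fps_subring A)" and L: "ideal L (fps_subring A)"
    and "K \<subseteq> L" and "order_ge N \<subseteq> K" and vals: "value_set L \<subseteq> value_set K"
  shows "L \<subseteq> K"
proof -
  have "f \<in> K" if "f \<in> L" "f \<in> order_ge (N - n)" for n f
    using that
  proof (induction n arbitrary: f)
    case 0
    then show ?case using assms(4) by auto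
  next
    case (Suc n)
    define s where "s = N - Suc n"
    show ?case
    proof (cases "n < N \<and> f $ s \<noteq> 0")
      case False
      have "f \<in> order_ge (N - n)"
        unfolding order_ge_def
      proof (clarify)
        fix i assume "i < N - n"
        then have "i < s \<or> (i = s \<and> n < N)" by (auto simp: s_def)
        then show "f $ i = 0"
          using False Suc.prems(2) by (auto simp: s_def order_ge_def)
      qed
      then show ?thesis using Suc by blast
    next
      case True
      have s: "subdegree f = s"
        using True Suc.prems(2) by (intro subdegreeI) (auto simp: s_def order_ge_def)
      have "f \<noteq> 0" using True by auto
      with s Suc.prems(1) have "s \<in> value_set K"
        using vals by (auto simp: value_set_def)
      then obtain h where h: "h \<in> K" "h \<noteq> 0" "subdegree h = s" by (rule value_setE)
      have hs: "h $ s \<noteq> 0" using h by auto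
      have "f $ s / h $ s \<in> (\<lambda>f. fps_nth f 0) ` A" using residually_rational by simp
      then obtain a where a: "a \<in> A" "a $ 0 = f $ s / h $ s" by auto
      have ah: "a * h \<in> K" using ideal_mult[OF K a(1) h(1)] .
      have "(a * h) $ s = f $ s"
        using nth_subdegree_mult_right[of a h] h a hs by simp
      moreover have "(a * h) \<in> order_ge s"
        using order_ge_mult_left[of h s a] h by (simp add: order_ge_iff)
      ultimately have "f - a * h \<in> order_ge (Suc s)"
        using Suc.prems(2) by (auto simp: order_ge_def less_Suc_eq s_def)
      then have "f - a * h \<in> order_ge (N - n)" using True by (simp add: s_def Suc_diff_Suc)
      moreover have "f - a * h \<in> L"
        using ideal_diff[OF L Suc.prems(1)] ah \<open>K \<subseteq> L\<close> by blast
      ultimately have "f - a * h \<in> K" using Suc.IH by blast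
      then show ?thesis using ideal_add[OF K _ ah, of "f - a * h"] by simp
    qed
  qed
  from this[of _ N] show ?thesis by auto
qed

lemma value_set_diff_less:
  fixes I J :: "'k fps set"
  assumes "order_ge N \<subseteq> J" and "s \<in> value_set I - value_set J"
  shows "s < N"
proof (rule ccontr)
  assume "\<not> s < N"
  from assms(2) obtain f :: "'k fps" where f: "f \<noteq> 0" "subdegree f = s"
    by (blast elim: value_setE)
  with \<open>\<not> s < N\<close> have "f \<in> J" using assms(1) by (auto simp: order_ge_iff)
  with assms(2) f show False by (auto simp: value_set_def)
qed

lemma finite_value_set_diff:
  fixes I J :: "'k fps set"
  assumes "order_ge N \<subseteq> J"
  shows "finite (value_set I - value_set J)"
  using finite_subset[of "value_set I - value_set J" "{..<N}"] value_set_diff_less[OF assms]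
  by auto

lemma ideal_chain_bounded:
  assumes tail: "order_ge N \<subseteq> J"
    and K: "\<forall>i\<le>n. ideal (K i) (fps_subring A) \<and> J \<subseteq> K i \<and> K i \<subseteq> I"
    and strict: "\<forall>i<n. K i \<subset> K (Suc i)"
  shows "n \<le> card (value_set I - value_set J)"
proof -
  have "i \<le> n \<Longrightarrow> i \<le> card (value_set (K i) - value_set J)" for i
  proof (induction i)
    case (Suc i)
    have Ki: "ideal (K i) (fps_subring A)" "J \<subseteq> K i" "K i \<subset> K (Suc i)"
      "ideal (K (Suc i)) (fps_subring A)"
      using K strict Suc.prems by auto
    have "\<not> value_set (K (Suc i)) \<subseteq> value_set (K i)"
      using ideal_subset_if_value_set_subset[OF Ki(1,4), of N] Ki tail by blast
    moreover have "value_set (K i) \<subseteq> value_set (K (Suc i))"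
      using Ki by (intro value_set_mono) blast
    moreover have "value_set J \<subseteq> value_set (K i)"
      using Ki by (intro value_set_mono)
    ultimately have "value_set (K i) - value_set J \<subset> value_set (K (Suc i)) - value_set J"
      by blast
    then have "card (value_set (K i) - value_set J) < card (value_set (K (Suc i)) - value_set J)"
      by (rule psubset_card_mono[OF finite_value_set_diff[OF tail]])
    with Suc show ?case by simp
  qed simp
  from this[of n] have "n \<le> card (value_set (K n) - value_set J)" by simp
  also have "\<dots> \<le> card (value_set I - value_set J)"
    using K value_set_mono[of "K n" I]
    by (intro card_mono finite_value_set_diff[OF tail]) auto
  finally show ?thesis .
qed

text \<open>
  The chain consists of the ideals \<open>L s = I \<inter> (J + order_ge s)\<close>.  If \<open>s\<close> is the value of some
  \<open>f\<close> in \<open>I\<close> but not a value of \<open>J\<close>, then \<open>f\<close> lies in \<open>L s\<close> but not in \<open>L (s + 1)\<close>: otherwise \<open>f\<close>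
  would share its leading term with an element of \<open>J\<close>.
\<close>

lemma ideal_chain_exists:
  assumes I: "ideal I (fps_subring A)" and J: "ideal J (fps_subring A)" and "J \<subseteq> I"
    and tail: "order_ge N \<subseteq> J"
  shows "\<exists>K. (\<forall>i\<le>card (value_set I - value_set J).
                 ideal (K i) (fps_subring A) \<and> J \<subseteq> K i \<and> K i \<subseteq> I) \<and>
             (\<forall>i<card (value_set I - value_set J). K i \<subset> K (Suc i))"
proof -
  define D where "D = value_set I - value_set J"
  define L where "L s = {f \<in> I. \<exists>j\<in>J. f - j \<in> order_ge s}" for s
  have L_ideal: "ideal (L s) (fps_subring A)" for s
    unfolding ideal_iff
  proof (intro conjI ballI)
    show "L s \<subseteq> A" using ideal_subset[OF I] by (auto simp: L_def)
    show "0 \<in> L s" using ideal_zero[OF I] ideal_zero[OF J] by (auto simp: L_def intro!: bexI[of _ 0])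
  next
    fix f g assume "f \<in> L s" "g \<in> L s"
    then obtain i j where "f \<in> I" "g \<in> I" "i \<in> J" "j \<in> J"
      "f - i \<in> order_ge s" "g - j \<in> order_ge s" by (auto simp: L_def)
    moreover from this have "(f + g) - (i + j) \<in> order_ge s"
      using order_ge_add[of "f - i" s "g - j"] by (simp add: algebra_simps)
    ultimately show "f + g \<in> L s"
      using ideal_add[OF I] ideal_add[OF J] unfolding L_def by blast
  next
    fix a f assume "a \<in> A" "f \<in> L s"
    then obtain j where "f \<in> I" "j \<in> J" "f - j \<in> order_ge s" by (auto simp: L_def)
    moreover from this have "a * f - a * j \<in> order_ge s"
      using order_ge_mult_left[of "f - j" s a] by (simp add: algebra_simps)
    ultimately show "a * f \<in> L s"
      using ideal_mult[OF I \<open>a \<in> A\<close>] ideal_mult[OF J \<open>a \<in> A\<close>] unfolding L_def by blast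
  qed
  have L_between: "J \<subseteq> L s" "L s \<subseteq> I" for s
    using \<open>J \<subseteq> I\<close> by (auto simp: L_def intro!: bexI)
  have L_Suc: "L (Suc s) \<subseteq> L s" for s
    using order_ge_mono[of _ "Suc s" s] unfolding L_def by auto
  have L_strict: "L (Suc s) \<subset> L s" if "s \<in> D" for s
  proof -
    from that obtain f where f: "f \<in> I" "f \<noteq> 0" "subdegree f = s"
      unfolding D_def by (auto elim: value_setE)
    have "f \<in> L s"
      using f ideal_zero[OF J] by (auto simp: L_def order_ge_iff intro!: bexI[of _ 0])
    moreover have "f \<notin> L (Suc s)"
    proof
      assume "f \<in> L (Suc s)"
      then obtain j where j: "j \<in> J" "f - j \<in> order_ge (Suc s)" by (auto simp: L_def)
      have eq: "j $ i = f $ i" if "i \<le> s" for i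
      proof -
        have "\<forall>i<Suc s. (f - j) $ i = 0" using j(2) unfolding order_ge_def by (rule CollectD)
        then have "(f - j) $ i = 0" using that less_Suc_eq_le by blast
        then show ?thesis by simp
      qed
      have "f $ s \<noteq> 0" using nth_subdegree_nonzero[OF f(2)] by (simp only: f(3) not_False_eq_True)
      then have js: "j $ s \<noteq> 0" using eq[of s] by simp
      have j0: "j $ i = 0" if "i < s" for i
        using eq[of i] nth_less_subdegree_zero[of i f] that f(3) by simp
      have "j \<noteq> 0" using js by auto
      moreover have "subdegree j = s" using js j0 by (rule subdegreeI)
      ultimately have "s \<in> value_set J" using j(1) by (auto simp: value_set_def)
      with that show False by (simp add: D_def)
    qed
    ultimately show ?thesis using L_Suc[of s] by blast
  qed
  have finite_D: "finite D" unfolding D_def by (rule finite_value_set_diff[OF tail])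
  have D_less: "s < N" if "s \<in> D" for s
    using that value_set_diff_less[OF tail] by (auto simp: D_def)
  \<comment> \<open>The chain grows by \<open>L s\<close> whenever \<open>s = N - m\<close>, counted down from \<open>N\<close>, meets an element of \<open>D\<close>.\<close>
  have chain: "\<exists>K. (\<forall>i\<le>card {s \<in> D. N - m \<le> s}. ideal (K i) (fps_subring A) \<and> J \<subseteq> K i \<and> K i \<subseteq> I) \<and>
      (\<forall>i<card {s \<in> D. N - m \<le> s}. K i \<subset> K (Suc i)) \<and> K (card {s \<in> D. N - m \<le> s}) \<subseteq> L (N - m)"
    for m
  proof (induction m)
    case 0
    have "{s \<in> D. N - 0 \<le> s} = {}" using D_less by fastforce
    then show ?case using L_ideal L_between by (intro exI[of _ "\<lambda>_. L N"]) (simp del: Collect_empty_eq)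
  next
    case (Suc m)
    let ?c = "card {s \<in> D. N - m \<le> s}"
    from Suc obtain K where K: "\<forall>i\<le>?c. ideal (K i) (fps_subring A) \<and> J \<subseteq> K i \<and> K i \<subseteq> I"
      "\<forall>i<?c. K i \<subset> K (Suc i)" "K ?c \<subseteq> L (N - m)" by blast
    show ?case
    proof (cases "m < N \<and> N - Suc m \<in> D")
      case True
      then have "{s \<in> D. N - Suc m \<le> s} = insert (N - Suc m) {s \<in> D. N - m \<le> s}" by auto
      moreover have "N - Suc m \<notin> {s \<in> D. N - m \<le> s}" using True by auto
      ultimately have c: "card {s \<in> D. N - Suc m \<le> s} = Suc ?c"
        using finite_D by simp
      define K' where "K' = K(Suc ?c := L (N - Suc m))"
      have "L (N - m) \<subset> L (N - Suc m)"
        using L_strict[of "N - Suc m"] True by (simp add: Suc_diff_Suc)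
      with K(3) have "K ?c \<subset> L (N - Suc m)" by (rule subset_psubset_trans)
      with K(2) have "\<forall>i<Suc ?c. K' i \<subset> K' (Suc i)"
        by (simp add: K'_def less_Suc_eq)
      moreover have "\<forall>i\<le>Suc ?c. ideal (K' i) (fps_subring A) \<and> J \<subseteq> K' i \<and> K' i \<subseteq> I"
        using K(1) L_ideal L_between by (auto simp: K'_def le_Suc_eq)
      ultimately show ?thesis unfolding c by (intro exI[of _ K']) (simp add: K'_def)
    next
      case False
      have c: "{s \<in> D. N - Suc m \<le> s} = {s \<in> D. N - m \<le> s}"
      proof (intro Collect_cong conj_cong refl)
        fix s assume "s \<in> D"
        with False have "s \<noteq> N - Suc m \<or> N \<le> m" by auto
        then show "N - Suc m \<le> s \<longleftrightarrow> N - m \<le> s" by auto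
      qed
      have "L (N - m) \<subseteq> L (N - Suc m)"
        using L_Suc[of "N - Suc m"] by (cases "m < N") (simp_all add: Suc_diff_Suc)
      with K show ?thesis unfolding c by (intro exI[of _ K]) simp
    qed
  qed
  have "{s \<in> D. N - N \<le> s} = D" by simp
  with chain[of N] show ?thesis unfolding D_def by metis
qed

theorem length_eq_card_value_diff:
  assumes I: "ideal I (fps_subring A)" and J: "ideal J (fps_subring A)" and "J \<subseteq> I"
    and tail: "order_ge N \<subseteq> J"
  shows "module_length (fps_subring A) (ideal_quotient A I J) =
         enat (card (value_set I - value_set J))"
  unfolding module_length_def submodule_chain_iff_ideal_chain[OF I J \<open>J \<subseteq> I\<close>]
proof (rule antisym)
  show "Sup {enat n | n. \<exists>K. (\<forall>i\<le>n. ideal (K i) (fps_subring A) \<and> J \<subseteq> K i \<and> K i \<subseteq> I) \<and>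
              (\<forall>i<n. K i \<subset> K (Suc i))} \<le> enat (card (value_set I - value_set J))"
    using ideal_chain_bounded[OF tail] by (intro Sup_least) auto
  show "enat (card (value_set I - value_set J)) \<le>
        Sup {enat n | n. \<exists>K. (\<forall>i\<le>n. ideal (K i) (fps_subring A) \<and> J \<subseteq> K i \<and> K i \<subseteq> I) \<and>
              (\<forall>i<n. K i \<subset> K (Suc i))}"
    using ideal_chain_exists[OF assms] by (intro Sup_upper) blast
qed

text \<open>
  The elements of \<open>A\<close> with zero constant coefficient form the kernel of a surjection onto the field
  and hence a maximal ideal; a local ring has only one.
\<close>

lemma maximal_ideal_eq:
  assumes "local_ring (fps_subring A) \<mm>"
  shows "\<mm> = {f \<in> A. f $ 0 = 0}"
proof -
  let ?n = "{f \<in> A. f $ 0 = 0}"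
  have n: "ideal ?n (fps_subring A)"
    unfolding ideal_iff by (auto simp: zero_A add_A mult_A)
  have "maximalideal ?n (fps_subring A)"
  proof (rule maximalidealI[OF n])
    show "carrier (fps_subring A) \<noteq> ?n" using one_A by force
    fix J assume J: "ideal J (fps_subring A)" "?n \<subseteq> J" "J \<subseteq> carrier (fps_subring A)"
    show "J = ?n \<or> J = carrier (fps_subring A)"
    proof (cases "J \<subseteq> ?n")
      case False
      then obtain f where f: "f \<in> J" "f $ 0 \<noteq> 0" using J(3) by auto
      have "inverse (f $ 0) \<in> (\<lambda>f. fps_nth f 0) ` A" using residually_rational by simp
      then obtain a where a: "a \<in> A" "a $ 0 = inverse (f $ 0)" by auto
      have af: "a * f \<in> J" using ideal_mult[OF J(1) a(1) f(1)] .
      have "1 + - (a * f) \<in> ?n"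
        using af J(3) f(2) a(2) add_A[OF one_A minus_A[of "a * f"]] by auto
      then have "(1 + - (a * f)) + a * f \<in> J" using J(2) ideal_add[OF J(1) _ af] by blast
      then have "1 \<in> J" by simp
      then have "A \<subseteq> J" using ideal_mult[OF J(1), of _ 1] by auto
      with J(3) show ?thesis by auto
    qed (use J in blast)
  qed
  then show ?thesis using assms by (simp add: local_ring_def)
qed

end


section \<open>The Apery filtration\<close>

lemma ideal_power_0: "ideal_power (fps_subring A) \<mm> 0 = A"
  and ideal_power_Suc:
    "ideal_power (fps_subring A) \<mm> (Suc i) = ideal_power (fps_subring A) \<mm> i \<cdot>\<^bsub>fps_subring A\<^esub> \<mm>"
  by (simp_all add: ideal_power_def ideals_set_def nat_pow_def)

lemma apery_filtration_eq:
  "apery_filtration A \<mm> x i = {p + a * x | p a. p \<in> ideal_power (fps_subring A) \<mm> i \<and> a \<in> A}"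
  by (auto simp: apery_filtration_def set_add_def' cgenideal_def)

locale apery_setup = residually_rational_subring A for A :: "('k::field) fps set" +
  fixes \<mm> :: "'k fps set" and x :: "'k fps" and e :: nat
  assumes local: "local_ring (fps_subring A) \<mm>"
    and conductor: "conductor A \<noteq> {0}"
    and x: "x \<in> A" "x \<noteq> 0" "subdegree x = e" and e: "e > 0"
    and e_least: "\<forall>a\<in>A. a \<noteq> 0 \<and> subdegree a > 0 \<longrightarrow> e \<le> subdegree a"
begin

abbreviation "F i \<equiv> apery_filtration A \<mm> x i"
abbreviation "mpow i \<equiv> ideal_power (fps_subring A) \<mm> i"

lemma m_ideal: "ideal \<mm> (fps_subring A)"
  using local by (auto simp: local_ring_def intro: maximalideal.axioms)

lemma mpow_ideal: "ideal (mpow i) (fps_subring A)"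
proof (induction i)
  case 0
  then show ?case by (auto simp: ideal_power_0 ideal_iff zero_A add_A mult_A)
next
  case (Suc i)
  then show ?case
    by (simp add: ideal_power_Suc ring.ideal_prod_is_ideal[OF ring_A] m_ideal)
qed

lemma mpow_Suc_subset: "mpow (Suc i) \<subseteq> mpow i"
  using ring.ideal_prod_inter[OF ring_A mpow_ideal m_ideal] by (auto simp: ideal_power_Suc)

lemma mpow_order: "mpow i \<subseteq> order_ge (i * e)"
proof (induction i)
  case (Suc i)
  have m: "\<mm> \<subseteq> order_ge e"
    using e_least unfolding maximal_ideal_eq[OF local]
    by (auto simp: order_ge_iff) (metis gr0I subdegree_eq_0_iff)
  show ?case
  proof
    fix f assume "f \<in> mpow (Suc i)"
    then have "f \<in> mpow i \<cdot>\<^bsub>fps_subring A\<^esub> \<mm>" by (simp add: ideal_power_Suc)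
    then show "f \<in> order_ge (Suc i * e)"
    proof (induction rule: ideal_prod.induct)
      case (prod p q)
      then have "p * q \<in> order_ge (i * e + e)"
        using Suc.IH m by (intro order_ge_mult) auto
      then show ?case by (simp add: add.commute)
    qed (simp add: order_ge_add)
  qed
qed auto

lemma F_ideal: "ideal (F i) (fps_subring A)"
proof -
  note P = mpow_ideal[of i]
  show ?thesis
    unfolding ideal_iff apery_filtration_eq
  proof (intro conjI ballI)
    show "{p + a * x | p a. p \<in> mpow i \<and> a \<in> A} \<subseteq> A"
      using ideal_subset[OF P] x(1) by (auto intro!: add_A mult_A)
    have "0 = 0 + 0 * x" by simp
    then show "0 \<in> {p + a * x | p a. p \<in> mpow i \<and> a \<in> A}"
      using ideal_zero[OF P] zero_A by blast
  next
    fix f g assume "f \<in> {p + a * x | p a. p \<in> mpow i \<and> a \<in> A}"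
      "g \<in> {p + a * x | p a. p \<in> mpow i \<and> a \<in> A}"
    then obtain p a q b where "f = p + a * x" "g = q + b * x" "p \<in> mpow i" "q \<in> mpow i"
      "a \<in> A" "b \<in> A" by blast
    moreover from this have "f + g = (p + q) + (a + b) * x" by (simp add: algebra_simps)
    ultimately show "f + g \<in> {p + a * x | p a. p \<in> mpow i \<and> a \<in> A}"
      using ideal_add[OF P] add_A by blast
  next
    fix b f assume b: "b \<in> A" and "f \<in> {p + a * x | p a. p \<in> mpow i \<and> a \<in> A}"
    then obtain p a where "f = p + a * x" "p \<in> mpow i" "a \<in> A" by blast
    moreover from this have "b * f = b * p + (b * a) * x" by (simp add: algebra_simps)
    ultimately show "b * f \<in> {p + a * x | p a. p \<in> mpow i \<and> a \<in> A}"
      using ideal_mult[OF P b] mult_A[OF b] by blast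
  qed
qed

lemma F_antimono: "i \<le> j \<Longrightarrow> F j \<subseteq> F i"
proof (rule lift_Suc_antimono_le[of F])
  show "F (Suc n) \<subseteq> F n" for n
    using mpow_Suc_subset[of n] unfolding apery_filtration_eq by blast
qed

lemma F_0: "F 0 = A"
proof
  show "F 0 \<subseteq> A" using ideal_subset[OF F_ideal] .
  show "A \<subseteq> F 0"
  proof
    fix f assume "f \<in> A"
    moreover have "f = f + 0 * x" by simp
    ultimately show "f \<in> F 0" using zero_A unfolding apery_filtration_eq ideal_power_0 by blast
  qed
qed

lemma xA_subset_F: "a \<in> A \<Longrightarrow> a * x \<in> F i"
proof -
  assume a: "a \<in> A"
  have "a * x = 0 + a * x" by simp
  then show ?thesis using a ideal_zero[OF mpow_ideal] unfolding apery_filtration_eq by blast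
qed

text \<open>
  A nonzero \<open>f\<close> in the conductor puts every multiple of \<open>f\<close>, that is every series of order at
  least that of \<open>f\<close>, into \<open>A\<close>; multiplication by \<open>x\<close> raises the order by \<open>e\<close>.
\<close>

lemma order_ge_subset_xA:
  obtains N where "order_ge N \<subseteq> {a * x | a. a \<in> A}"
proof -
  have "0 \<in> conductor A" by (simp add: conductor_def zero_A)
  with conductor obtain f where f: "f \<in> conductor A" "f \<noteq> 0" by blast
  have "order_ge (e + subdegree f) \<subseteq> {a * x | a. a \<in> A}"
  proof
    fix g :: "'k fps" assume "g \<in> order_ge (e + subdegree f)"
    then obtain h where h: "g = x * h" "h \<in> order_ge (subdegree f)"
      using order_ge_imp_dvd[of x g "subdegree f"] x by auto
    then obtain h' where "h = f * h'"
      using order_ge_imp_dvd[of f h 0] f by auto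
    then have "h \<in> A" using f by (simp add: conductor_def)
    then show "g \<in> {a * x | a. a \<in> A}" using h by (auto simp: mult.commute)
  qed
  then show ?thesis by (rule that)
qed

lemma order_ge_subset_F: obtains N where "\<And>i. order_ge N \<subseteq> F i"
proof -
  obtain N where N: "order_ge N \<subseteq> {a * x | a. a \<in> A}" by (rule order_ge_subset_xA)
  have "order_ge N \<subseteq> F i" for i using N xA_subset_F by blast
  then show ?thesis using that by blast
qed

text \<open>The elements of \<open>\<mm>^N\<close> have order at least \<open>N * e\<close>, which is at least \<open>N\<close>.\<close>

lemma F_subset_xA: obtains N where "F N \<subseteq> {a * x | a. a \<in> A}"
proof -
  obtain N where N: "order_ge N \<subseteq> {a * x | a. a \<in> A}" by (rule order_ge_subset_xA)
  have "N \<le> N * e" using e by simp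
  then have mN: "mpow N \<subseteq> {a * x | a. a \<in> A}"
    using mpow_order[of N] order_ge_mono N by blast
  have "F N \<subseteq> {a * x | a. a \<in> A}"
  proof
    fix f assume "f \<in> F N"
    then obtain p a where "f = p + a * x" "p \<in> mpow N" "a \<in> A"
      unfolding apery_filtration_eq by blast
    moreover from this obtain b where "p = b * x" "b \<in> A" using mN by blast
    ultimately have "f = (b + a) * x" "b + a \<in> A" by (auto simp: algebra_simps add_A)
    then show "f \<in> {a * x | a. a \<in> A}" by blast
  qed
  then show ?thesis by (rule that)
qed

lemma apery_invariant_eq:
  "apery_invariant A \<mm> x i = enat (card (value_set (F i) - value_set (F (Suc i))))"
proof -
  obtain N where "\<And>i. order_ge N \<subseteq> F i" using order_ge_subset_F by blast
  then show ?thesis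
    unfolding apery_invariant_def
    by (intro length_eq_card_value_diff F_ideal F_antimono) auto
qed

lemma apery_value_not_shifted:
  assumes "s \<in> apery_set (value_set A) e"
  shows "s \<notin> value_set {a * x | a. a \<in> A}"
proof
  assume "s \<in> value_set {a * x | a. a \<in> A}"
  then obtain f where f: "f \<in> {a * x | a. a \<in> A}" "f \<noteq> 0" "subdegree f = s"
    by (rule value_setE)
  then obtain a where a: "a \<in> A" "f = a * x" by blast
  then have "a \<noteq> 0" "s = subdegree a + e" using f x by auto
  moreover from this have "subdegree a \<in> value_set A" using a by (auto simp: value_set_def)
  ultimately have "s \<le> subdegree a" using assms by (auto simp: apery_set_def)
  then show False using \<open>s = subdegree a + e\<close> e by simp
qed

text \<open>
  If \<open>s\<close> were not the least value in its class modulo \<open>e\<close>, then multiplying an element of smaller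
  value in that class by a positive power of \<open>x\<close> would give an element of \<open>xA \<subseteq> F i\<close> of value \<open>s\<close>.
\<close>

lemma value_not_F_imp_apery:
  assumes "s \<in> value_set A" "s \<notin> value_set (F i)"
  shows "s \<in> apery_set (value_set A) e"
  unfolding apery_set_def
proof (clarsimp simp: assms(1))
  fix s' assume s': "s' \<in> value_set A" "s' mod e = s mod e"
  show "s \<le> s'"
  proof (rule ccontr)
    assume less: "\<not> s \<le> s'"
    then have "e dvd s - s'" using s' mod_eq_dvd_iff_nat[of s' s e] by simp
    then obtain q where q: "s - s' = e * q" by (rule dvdE)
    with less have "q \<noteq> 0" by (cases q) auto
    then obtain r where r: "q = Suc r" using not0_implies_Suc by blast
    from s' obtain f where f: "f \<in> A" "f \<noteq> 0" "subdegree f = s'" by (blast elim: value_setE)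
    have "x ^ r \<in> A" by (induction r) (auto simp: one_A mult_A x)
    then have "(x ^ r * f) * x \<in> F i" using f by (intro xA_subset_F mult_A)
    moreover have "(x ^ r * f) * x \<noteq> 0" using f x by simp
    moreover have "subdegree ((x ^ r * f) * x) = s" using f x q r less by (simp add: algebra_simps)
    ultimately show False using assms(2) by (auto simp: value_set_def intro!: image_eqI)
  qed
qed

text \<open>
  The indices \<open>i\<close> with \<open>s \<in> v(F i)\<close> form an initial segment of the natural numbers.  It contains 0
  since \<open>F 0 = A\<close>, and it is bounded since \<open>F N \<subseteq> xA\<close> for some \<open>N\<close>.
\<close>

lemma value_F_iff_le_Max:
  assumes "s \<in> apery_set (value_set A) e"
  shows "s \<in> value_set (F i) \<longleftrightarrow> i \<le> Max {i. s \<in> value_set (F i)}"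
proof -
  let ?X = "{i. s \<in> value_set (F i)}"
  obtain N where N: "F N \<subseteq> {a * x | a. a \<in> A}" by (rule F_subset_xA)
  have down: "i \<in> ?X" if "j \<in> ?X" "i \<le> j" for i j
    using that value_set_mono[OF F_antimono[OF that(2)]] by blast
  have "N \<notin> ?X" using value_set_mono[OF N] apery_value_not_shifted[OF assms] by blast
  then have "?X \<subseteq> {..N}" using down by (metis atMost_iff nat_le_linear subsetI)
  then have fin: "finite ?X" by (rule finite_subset) simp
  have "0 \<in> ?X" using assms by (simp add: F_0 apery_set_def)
  then have "Max ?X \<in> ?X" using fin by (intro Max_in) auto
  then show ?thesis using down fin Max_ge[OF fin] by blast
qed

lemma zero_not_value_F: "i \<ge> 1 \<Longrightarrow> 0 \<notin> value_set (F i)"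
proof
  assume i: "i \<ge> 1" and "0 \<in> value_set (F i)"
  then obtain f where f: "f \<in> F i" "f \<noteq> 0" "subdegree f = 0" by (blast elim: value_setE)
  then obtain p a where p: "f = p + a * x" "p \<in> mpow i"
    unfolding apery_filtration_eq by blast
  have "i * e \<ge> e" using i by (cases i) auto
  then have "p \<in> order_ge e" using mpow_order p(2) order_ge_mono by blast
  moreover have "a * x \<in> order_ge e" using x by (intro order_ge_mult_left) (simp add: order_ge_iff)
  ultimately have "f \<in> order_ge e" using p(1) order_ge_add by blast
  with f e show False by (simp add: order_ge_iff)
qed

end


section \<open>Apery invariants and Apery bases\<close>

theorem lemma2p13:
  fixes A \<mm> :: "('k::field) fps set"
    and x :: "'k fps"
    and e :: nat
    and w :: "nat \<Rightarrow> nat"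
    and g :: "nat \<Rightarrow> 'k fps"
    and c :: "nat \<Rightarrow> nat"
  assumes "infinite (UNIV :: 'k set)"
    and "residually_rational_local_subring A \<mm>"
    and "has_multiplicity_dim1 (fps_subring A) \<mm> e"
    and "x \<in> A" and "x \<noteq> 0" and "subdegree x = e" and "e > 0"
    and "\<forall>a\<in>A. a \<noteq> 0 \<and> subdegree a > 0 \<longrightarrow> e \<le> subdegree a"
    and "apery_basis A \<mm> x e w g"
    and "\<forall>j\<in>{1..<e}. c j = Max {i. g j \<in> apery_filtration A \<mm> x i}"
  shows "\<forall>i\<ge>1. apery_invariant A \<mm> x i = enat (card {j \<in> {1..<e}. c j = i})"
proof (intro allI impI)
  fix i :: nat assume i: "i \<ge> 1"
  interpret apery_setup A \<mm> x e
    using assms(2,4-8) unfolding residually_rational_local_subring_def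
    by (intro apery_setup.intro residually_rational_subring.intro power_series_subring.intro
        residually_rational_subring_axioms.intro apery_setup_axioms.intro) simp_all
  have w0: "w 0 = 0" and w: "bij_betw w {0..<e} (apery_set (value_set A) e)"
    using assms(9) by (auto simp: apery_basis_def)
  have c: "c j = Max {i. w j \<in> value_set (F i)}" if "j \<in> {1..<e}" for j
    using assms(9,10) that by (auto simp: apery_basis_def)
  have iff: "w j \<in> value_set (F k) \<longleftrightarrow> k \<le> c j" if "j \<in> {1..<e}" for j k
  proof -
    have "w j \<in> apery_set (value_set A) e" using bij_betwE[OF w] that by auto
    then show ?thesis unfolding c[OF that] by (rule value_F_iff_le_Max)
  qed
  have "value_set (F i) - value_set (F (Suc i)) = w ` {j \<in> {1..<e}. c j = i}"
  proof (intro equalityI subsetI)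
    fix s assume s: "s \<in> value_set (F i) - value_set (F (Suc i))"
    have "value_set (F i) \<subseteq> value_set A" using value_set_mono[OF F_antimono[of 0 i]] F_0 by simp
    with s have "s \<in> apery_set (value_set A) e" using value_not_F_imp_apery by blast
    then have "s \<in> w ` {0..<e}" using bij_betw_imp_surj_on[OF w] by simp
    then obtain j where j: "j < e" "s = w j" by auto
    have "j \<noteq> 0" using s j w0 zero_not_value_F[OF i] by (metis DiffD1)
    with j have "j \<in> {1..<e}" by simp
    moreover from this have "c j = i" using s j iff by auto
    ultimately show "s \<in> w ` {j \<in> {1..<e}. c j = i}" using j by blast
  qed (auto simp: iff)
  moreover have "inj_on w {j \<in> {1..<e}. c j = i}"
    using w by (auto simp: bij_betw_def intro: inj_on_subset)
  ultimately show "apery_invariant A \<mm> x i = enat (card {j \<in> {1..<e}. c j = i})"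
    by (simp add: apery_invariant_eq card_image)
qed

end
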